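(* Let $\mathcal G$ be a moral DAG with skeleton $G=(V,E)$, a finite graph, with parent function $\mathfrak{pa}$. 1) If $X\sim\operatorname{Dir}_G(\alpha,\beta)$ (with $\alpha\in(0,\infty)^V$, $\beta>0$) and $$U_i^{\mathcal G}=1-\frac{\Delta_{\overline{\mathfrak{de}}(i)}(X)}{\Delta_{\mathfrak{de}(i)}(X)},\qquad i\in V,$$ then the random variables $U_i^{\mathcal G}$, $i\in V$, are independent. Moreover, for every $i\in V$, $U_i^{\mathcal G}\sim\operatorname{B}_I(\alpha_i,\beta+|\alpha_{\mathfrak{pa}(i)}|)$. 2) If $Y\sim\operatorname{IDir}_G(\alpha,\beta)$ (with $\alpha\in(0,\infty)^V$, $\beta>\max_{C\in\mathcal C_G^+}|\alpha_C|$) and $$W_i^{\mathcal G}=\frac{\delta_{\overline{\mathfrak{de}}(i)}(Y)}{\delta_{\mathfrak{de}(i)}(Y)}-1,\qquad i\in V,$$ then the random variables $W_i^{\mathcal G}$, $i\in V$, are independent. Moreover, for every $i\in V$, $W_i^{\mathcal G}\sim\operatorname{B}_{II}(\alpha_i,\beta-|\alpha_{\overline{\mathfrak{pa}}(i)}|)$.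
   Context: $G=(V,E)$ is a finite undirected simple graph; $G^*$ its complement graph; $G_A$ the subgraph induced by $A\subset V$. A clique is a set of pairwise adjacent vertices ($\emptyset$ and singletons are cliques); $\mathcal C_G$ is the set of cliques and $\mathcal C_G^+$ the set of maximal cliques. A moral DAG $\mathcal G$ with skeleton $G$ is an orientation of all edges of $G$ without directed cycles such that any two distinct parents of a common vertex are adjacent (then $G$ is decomposable, i.e. chordal). $\mathfrak{pa}(i)=\{j:j\to i\}$, $\overline{\mathfrak{pa}}(i)=\mathfrak{pa}(i)\cup\{i\}$, $\mathfrak{de}(i)$ is the set of descendants of $i$ (vertices reachable from $i$ by a directed path of length at least 1), $\overline{\mathfrak{de}}(i)=\mathfrak{de}(i)\cup\{i\}$. $\Delta_G(x)=\sum_{C\in\mathcal C_{G^*}}(-1)^{|C|}\prod_{i\in C}x_i$, $\delta_G(y)=\sum_{C\in\mathcal C_{G^*}}\prod_{i\in C}y_i$; for $A\subset V$, $\Delta_A(x):=\Delta_{G_A}(x_A)$, $\delta_A(y):=\delta_{G_A}(y_A)$, $\Delta_\emptyset=\delta_\emptyset=1$, $x_A=(x_i)_{i\in A}$. $M_G=\{x\in(0,\infty)^V:\Delta_A(x)>0\ \forall A\subset V\}$. $|\alpha_A|=\sum_{i\in A}\alpha_i$. $\operatorname{Dir}_G(\alpha,\beta)$ is the probability distribution on $\mathbb R^V$ with Lebesgue density proportional to $\Delta_G(x)^{\beta-1}\prod_{i\in V}x_i^{\alpha_i-1}\mathbf 1_{M_G}(x)$. $\operatorname{IDir}_G(\alpha,\beta)$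 is the probability distribution on $\mathbb R^V$ with density proportional to $\delta_G(y)^{-\beta}\prod_{i\in V}y_i^{\alpha_i-1}\mathbf 1_{(0,\infty)^V}(y)$. (These functions are integrable for the stated parameters.) $\operatorname{B}_I(a,b)$: beta distribution of the first kind, density proportional to $u^{a-1}(1-u)^{b-1}$ on $(0,1)$. $\operatorname{B}_{II}(a,b)$: beta distribution of the second kind, density proportional to $w^{a-1}(1+w)^{-(a+b)}$ on $(0,\infty)$. *)

theory Defs
  imports "HOL-Probability.Probability"
begin

record 'v graph =
  verts :: "'v set"
  adj :: "'v rel"

definition simple_graph :: "'v graph \<Rightarrow> bool" where
  "simple_graph G \<longleftrightarrow> finite (verts G) \<and> adj G \<subseteq> verts G \<times> verts G \<and> sym (adj G) \<and> irrefl (adj G)"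

definition complement :: "'v graph \<Rightarrow> 'v graph" where
  "complement G = \<lparr>verts = verts G,
     adj = {(i, j). i \<in> verts G \<and> j \<in> verts G \<and> i \<noteq> j \<and> (i, j) \<notin> adj G}\<rparr>"

definition induced :: "'v graph \<Rightarrow> 'v set \<Rightarrow> 'v graph" where
  "induced G A = \<lparr>verts = A, adj = adj G \<inter> A \<times> A\<rparr>"

definition cliques :: "'v graph \<Rightarrow> 'v set set" where
  "cliques G = {C. C \<subseteq> verts G \<and> (\<forall>i\<in>C. \<forall>j\<in>C. i \<noteq> j \<longrightarrow> (i, j) \<in> adj G)}"

definition max_cliques :: "'v graph \<Rightarrow> 'v set set" where
  "max_cliques G = {C \<in> cliques G. \<forall>C'\<in>cliques G. C \<subseteq> C' \<longrightarrow> C' = C}"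

text \<open>A directed graph is given by its arrow relation: \<open>(j, i) \<in> D\<close> means \<open>j \<rightarrow> i\<close>.\<close>

definition moral_dag :: "'v graph \<Rightarrow> 'v rel \<Rightarrow> bool" where
  "moral_dag G D \<longleftrightarrow> D \<union> D\<inverse> = adj G \<and> D \<inter> D\<inverse> = {} \<and> acyclic D \<and>
     (\<forall>i j k. (j, i) \<in> D \<and> (k, i) \<in> D \<and> j \<noteq> k \<longrightarrow> (j, k) \<in> adj G)"

definition pa :: "'v rel \<Rightarrow> 'v \<Rightarrow> 'v set" where
  "pa D i = {j. (j, i) \<in> D}"

definition pa_bar :: "'v rel \<Rightarrow> 'v \<Rightarrow> 'v set" where
  "pa_bar D i = insert i (pa D i)"

definition de :: "'v rel \<Rightarrow> 'v \<Rightarrow> 'v set" where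
  "de D i = {j. (i, j) \<in> D\<^sup>+}"

definition de_bar :: "'v rel \<Rightarrow> 'v \<Rightarrow> 'v set" where
  "de_bar D i = insert i (de D i)"

definition Delta :: "'v graph \<Rightarrow> ('v \<Rightarrow> real) \<Rightarrow> real" where
  "Delta G x = (\<Sum>C\<in>cliques (complement G). (-1) ^ card C * (\<Prod>i\<in>C. x i))"

definition delta :: "'v graph \<Rightarrow> ('v \<Rightarrow> real) \<Rightarrow> real" where
  "delta G y = (\<Sum>C\<in>cliques (complement G). \<Prod>i\<in>C. y i)"

text \<open>The restriction \<open>x\<^sub>A\<close> is left implicit: \<open>Delta (induced G A) x\<close> and
  \<open>delta (induced G A) x\<close> only involve the values of \<open>x\<close> on \<open>A\<close>.\<close>

definition Delta_on :: "'v graph \<Rightarrow> 'v set \<Rightarrow> ('v \<Rightarrow> real) \<Rightarrow> real" where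
  "Delta_on G A x = Delta (induced G A) x"

definition delta_on :: "'v graph \<Rightarrow> 'v set \<Rightarrow> ('v \<Rightarrow> real) \<Rightarrow> real" where
  "delta_on G A y = delta (induced G A) y"

definition pos_orthant :: "'v graph \<Rightarrow> ('v \<Rightarrow> real) set" where
  "pos_orthant G = (\<Pi>\<^sub>E i\<in>verts G. {0<..})"

definition M_set :: "'v graph \<Rightarrow> ('v \<Rightarrow> real) set" where
  "M_set G = {x \<in> pos_orthant G. \<forall>A. A \<subseteq> verts G \<longrightarrow> Delta_on G A x > 0}"

text \<open>Lebesgue measure on \<open>\<real>\<^sup>V\<close>, whose points are the extensional functions on \<open>V\<close>.\<close>

definition lebesgue_on_verts :: "'v graph \<Rightarrow> ('v \<Rightarrow> real) measure" where
  "lebesgue_on_verts G = (\<Pi>\<^sub>M i\<in>verts G. lborel)"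

text \<open>The probability density proportional to a nonnegative \<open>f\<close> whose integral with respect to
  \<open>N\<close> is positive and finite.\<close>

definition normalized :: "'b measure \<Rightarrow> ('b \<Rightarrow> real) \<Rightarrow> 'b \<Rightarrow> ennreal" where
  "normalized N f x = ennreal (f x) / (\<integral>\<^sup>+ y. ennreal (f y) \<partial>N)"

definition Dir_density :: "'v graph \<Rightarrow> ('v \<Rightarrow> real) \<Rightarrow> real \<Rightarrow> ('v \<Rightarrow> real) \<Rightarrow> ennreal" where
  "Dir_density G \<alpha> \<beta> = normalized (lebesgue_on_verts G)
     (\<lambda>x. Delta G x powr (\<beta> - 1) * (\<Prod>i\<in>verts G. x i powr (\<alpha> i - 1)) * indicator (M_set G) x)"

definition IDir_density :: "'v graph \<Rightarrow> ('v \<Rightarrow> real) \<Rightarrow> real \<Rightarrow> ('v \<Rightarrow> real) \<Rightarrow> ennreal" where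
  "IDir_density G \<alpha> \<beta> = normalized (lebesgue_on_verts G)
     (\<lambda>y. delta G y powr (- \<beta>) * (\<Prod>i\<in>verts G. y i powr (\<alpha> i - 1)) * indicator (pos_orthant G) y)"

definition Beta1_density :: "real \<Rightarrow> real \<Rightarrow> real \<Rightarrow> ennreal" where
  "Beta1_density a b = normalized lborel
     (\<lambda>u. u powr (a - 1) * (1 - u) powr (b - 1) * indicator {0<..<1} u)"

definition Beta2_density :: "real \<Rightarrow> real \<Rightarrow> real \<Rightarrow> ennreal" where
  "Beta2_density a b = normalized lborel
     (\<lambda>w. w powr (a - 1) * (1 + w) powr (- (a + b)) * indicator {0<..} w)"

end

theory Submission
  imports Defs
begin

text \<open>Both halves are one statement about the polynomial \<open>delta\<close>, because \<open>Delta_A(x) = delta_A(-x)\<close>. With a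
sign \<open>s\<close> equal to \<open>-1\<close> (first part) or \<open>1\<close> (second part), put
\<open>w\<^sub>i = (delta_{de_bar i}(s y) / delta_{de i}(s y) - 1) / s\<close>; these are the \<open>U\<^sub>i\<close> and the \<open>W\<^sub>i\<close>.

Call a set of vertices descendant-closed if it contains the children of its elements. If \<open>i\<close> is a source
of a descendant-closed set \<open>B \<union> {i}\<close>, splitting the independent sets according to whether they contain
\<open>i\<close> gives \<open>delta_{B \<union> {i}}(s y) = delta_B(s y) + s y\<^sub>i delta_{B - ch i}(s y)\<close>. Morality is what makes
\<open>B - ch i\<close> descendant-closed again, so by induction
\<open>y\<^sub>i = w\<^sub>i \<Prod>\<^bsub>j \<in> ch i\<^esub> (1 + s w\<^sub>j)\<close> and \<open>delta_C(s y) = \<Prod>\<^bsub>j \<in> C\<^esub> (1 + s w\<^sub>j)\<close>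
for descendant-closed \<open>C\<close> (lemmas \<open>coord_recursion\<close> and \<open>delta_on_eq_prod\<close>). Hence \<open>y \<mapsto> w\<close> is a
triangular change of variables: given the coordinates of the descendants of \<open>i\<close>, it is the rescaling
\<open>w\<^sub>i = y\<^sub>i / c\<close> with \<open>c = \<Prod>\<^bsub>j \<in> ch i\<^esub> (1 + s w\<^sub>j)\<close>. When the sources are integrated out one
at a time, \<open>y\<^sub>i\<^bsup>\<alpha>\<^sub>i - 1\<^esup> dy\<^sub>i\<close> becomes \<open>c\<^bsup>\<alpha>\<^sub>i\<^esup> w\<^sub>i\<^bsup>\<alpha>\<^sub>i - 1\<^esup> dw\<^sub>i\<close>, and the
factor \<open>c\<^bsup>\<alpha>\<^sub>i\<^esup>\<close> spreads over the children of \<open>i\<close>. In the end every vertex \<open>j\<close> has received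
\<open>(1 + s w\<^sub>j)\<^bsup>\<alpha>\<^sub>i\<^esup>\<close> from each parent \<open>i\<close>, which accounts for the sums over \<open>pa j\<close> in the beta
parameters (lemma \<open>nn_integral_coord\<close>).

It remains to see that the support of the density is a product in the new coordinates, namely
\<open>0 < w\<^sub>i\<close> and \<open>0 < 1 + s w\<^sub>i\<close> for all \<open>i\<close> (lemma \<open>coord_range_iff_delta_on_pos\<close>). The point is the
positivity of \<open>Delta_A\<close> for sets \<open>A\<close> that are not descendant-closed: with respect to the moral DAG
induced on \<open>A\<close>, the same \<open>y\<close> has coordinates bounded above by the original ones, so they stay below \<open>1\<close>.

The joint density of the \<open>w\<^sub>i\<close> is thus a product, up to a constant, and the constant is determined by
the total mass being \<open>1\<close> (lemma \<open>indep_vars_and_distributed_of_product_formula\<close>).\<close>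

section \<open>Independence polynomials\<close>

lemma cliques_complement_induced:
  "cliques (complement (induced G A)) =
    {C. C \<subseteq> A \<and> (\<forall>i\<in>C. \<forall>j\<in>C. i \<noteq> j \<longrightarrow> (i, j) \<notin> adj G)}"
  by (auto simp: cliques_def complement_def induced_def)

lemma Delta_on_eq_delta_on:
  assumes "finite A"
  shows "Delta_on G A x = delta_on G A (\<lambda>i. - 1 * x i)"
  unfolding Delta_on_def Delta_def delta_on_def delta_def
  by (rule sum.cong) (simp_all add: prod_uminus)

text \<open>An independent set of \<open>A \<union> {i}\<close> either avoids \<open>i\<close>, or it is \<open>i\<close> together with an independent subset of
\<open>A\<close> containing no neighbour of \<open>i\<close>.\<close>

lemma delta_on_insert:
  assumes "simple_graph G" "finite A" "i \<notin> A"
  shows "delta_on G (insert i A) y = delta_on G A y + y i * delta_on G (A - adj G `` {i}) y"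
proof -
  define I where "I B = cliques (complement (induced G B))" for B
  have I: "I B = {C. C \<subseteq> B \<and> (\<forall>i\<in>C. \<forall>j\<in>C. i \<noteq> j \<longrightarrow> (i, j) \<notin> adj G)}" for B
    by (simp add: I_def cliques_complement_induced)
  have sym: "(j, k) \<in> adj G \<Longrightarrow> (k, j) \<in> adj G" for j k
    using assms(1) by (auto simp: simple_graph_def dest: symD)
  have fin: "finite (I B)" if "finite B" for B
    using that by (auto simp: I)
  have split: "I (insert i A) = I A \<union> insert i ` I (A - adj G `` {i})"
  proof (intro equalityI subsetI)
    fix C assume C: "C \<in> I (insert i A)"
    show "C \<in> I A \<union> insert i ` I (A - adj G `` {i})"
    proof (cases "i \<in> C")
      case True
      have "C = insert i (C - {i})" using True by auto
      moreover have "C - {i} \<in> I (A - adj G `` {i})"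
        using C True by (auto simp: I)
      ultimately show ?thesis by blast
    next
      case False
      then show ?thesis using C by (auto simp: I)
    qed
  next
    fix C assume "C \<in> I A \<union> insert i ` I (A - adj G `` {i})"
    then show "C \<in> I (insert i A)" by (auto simp: I dest: sym)
  qed
  have inj: "inj_on (insert i) (I (A - adj G `` {i}))"
    using assms(3) by (auto simp: inj_on_def I)
  have "delta_on G (insert i A) y
      = (\<Sum>C\<in>I A. \<Prod>j\<in>C. y j) + (\<Sum>C\<in>insert i ` I (A - adj G `` {i}). \<Prod>j\<in>C. y j)"
    unfolding delta_on_def delta_def I_def[symmetric] split
    by (rule sum.union_disjoint) (use assms in \<open>auto simp: fin, auto simp: I\<close>)
  also have "(\<Sum>C\<in>insert i ` I (A - adj G `` {i}). \<Prod>j\<in>C. y j)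
      = (\<Sum>C\<in>I (A - adj G `` {i}). y i * (\<Prod>j\<in>C. y j))"
    unfolding sum.reindex[OF inj] o_def
  proof (rule sum.cong)
    fix C assume "C \<in> I (A - adj G `` {i})"
    then have "C \<subseteq> A" by (auto simp: I)
    then have "finite C" "i \<notin> C" using assms finite_subset by auto
    then show "(\<Prod>j\<in>insert i C. y j) = y i * (\<Prod>j\<in>C. y j)" by simp
  qed simp
  finally show ?thesis
    by (simp add: delta_on_def delta_def I_def sum_distrib_left)
qed

lemma delta_on_pos:
  assumes "finite A" "\<And>i. i \<in> A \<Longrightarrow> 0 < y i"
  shows "0 < delta_on G A y"
proof -
  let ?I = "cliques (complement (induced G A))"
  have fin: "finite ?I" using assms(1) by (auto simp: cliques_complement_induced)
  have "(\<Prod>i\<in>{}. y i) \<le> (\<Sum>C\<in>?I. \<Prod>i\<in>C. y i)"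
    using assms(2) fin
    by (intro member_le_sum prod_nonneg)
      (auto simp: cliques_complement_induced less_imp_le subset_iff)
  then show ?thesis by (simp add: delta_on_def delta_def)
qed

lemma delta_on_empty: "delta_on G {} y = 1"
proof -
  have "cliques (complement (induced G {})) = {{}}" by (auto simp: cliques_complement_induced)
  then show ?thesis by (simp add: delta_on_def delta_def)
qed

lemma delta_on_cong:
  assumes "\<And>i. i \<in> A \<Longrightarrow> y i = z i"
  shows "delta_on G A y = delta_on G A z"
  unfolding delta_on_def delta_def
  by (intro sum.cong prod.cong refl) (use assms in \<open>auto simp: cliques_complement_induced\<close>)

lemma measurable_delta_on:
  assumes "A \<subseteq> B"
  shows "(\<lambda>y. delta_on G A (\<lambda>i. s * y i)) \<in> borel_measurable (\<Pi>\<^sub>M i\<in>B. lborel)"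
  unfolding delta_on_def delta_def
proof (intro borel_measurable_sum borel_measurable_prod borel_measurable_times)
  fix C i assume "C \<in> cliques (complement (induced G A))" "i \<in> C"
  then have "i \<in> B" using assms by (auto simp: cliques_complement_induced)
  then have "(\<lambda>y. y i) \<in> (\<Pi>\<^sub>M i\<in>B. lborel) \<rightarrow>\<^sub>M lborel" by (rule measurable_component_singleton)
  then show "(\<lambda>y. y i) \<in> borel_measurable (\<Pi>\<^sub>M i\<in>B. lborel)" by simp
qed simp

section \<open>Product formulas, independence and rescaled integrals\<close>

lemma prod_divide_ennreal:
  fixes a c :: "'i \<Rightarrow> ennreal"
  assumes "finite I" "\<And>i. i \<in> I \<Longrightarrow> c i \<noteq> 0 \<and> c i \<noteq> \<top>"
  shows "(\<Prod>i\<in>I. a i / c i) = (\<Prod>i\<in>I. a i) / (\<Prod>i\<in>I. c i)"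
  using assms
proof (induction I rule: finite_induct)
  case (insert i I)
  have "prod c I \<noteq> \<top>" using insert by (auto simp: ennreal_prod_eq_top)
  then have "inverse (c i * prod c I) = inverse (c i) * inverse (prod c I)"
    using insert by (intro ennreal_inverse_mult) (auto simp: less_top)
  then show ?case using insert by (simp add: divide_ennreal_def ac_simps)
qed (simp add: divide_ennreal_def)

text \<open>The constant \<open>Z\<close> is arbitrary: taking every \<open>B i\<close> to be the whole line shows that it is the product of
the masses \<open>c i\<close> of the \<open>g i\<close>, and that all of these are positive and finite. Dividing, the joint
probabilities become products of the probabilities given by the normalised densities.\<close>

lemma (in prob_space) indep_vars_and_distributed_of_product_formula:
  fixes W :: "'i \<Rightarrow> 'a \<Rightarrow> real" and g :: "'i \<Rightarrow> real \<Rightarrow> ennreal"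
  assumes fin: "finite I"
    and W: "\<And>i. i \<in> I \<Longrightarrow> W i \<in> borel_measurable M"
    and g[measurable]: "\<And>i. i \<in> I \<Longrightarrow> g i \<in> borel_measurable borel"
    and formula: "\<And>B. (\<And>i. i \<in> I \<Longrightarrow> B i \<in> sets borel) \<Longrightarrow>
      emeasure M {\<omega>\<in>space M. \<forall>i\<in>I. W i \<omega> \<in> B i} = (\<Prod>i\<in>I. \<integral>\<^sup>+w. g i w * indicator (B i) w \<partial>lborel) / Z"
  shows "indep_vars (\<lambda>_. borel) W I"
    and "\<And>i. i \<in> I \<Longrightarrow> distributed M lborel (W i) (\<lambda>w. g i w / (\<integral>\<^sup>+w. g i w \<partial>lborel))"
proof -
  define c where "c i = (\<integral>\<^sup>+w. g i w \<partial>lborel)" for i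
  have total: "(\<Prod>i\<in>I. c i) / Z = 1"
    using formula[of "\<lambda>_. UNIV"] by (simp add: emeasure_space_1 c_def)
  \<comment> \<open>In \<open>ennreal\<close> a quotient equals 1 only if the divisor is neither 0 nor infinite.\<close>
  then have Z: "Z \<noteq> 0" "Z \<noteq> \<top>" "(\<Prod>i\<in>I. c i) = Z"
    unfolding divide_eq_1_ennreal by auto
  have c0: "c i \<noteq> 0" if "i \<in> I" for i
    using Z(1) fin that prod_zero[of I c] unfolding Z(3)[symmetric] by blast
  have ct: "c i \<noteq> \<top>" if "i \<in> I" for i
    using Z(2) c0 fin that unfolding Z(3)[symmetric] by (auto simp: ennreal_prod_eq_top)
  define p where "p i B = (\<integral>\<^sup>+w. g i w * indicator B w \<partial>lborel) / c i" for i B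
  have p_UNIV: "p i UNIV = 1" if "i \<in> I" for i
    using c0 ct that by (simp add: p_def divide_eq_1_ennreal flip: c_def)
  have formula': "emeasure M {\<omega>\<in>space M. \<forall>i\<in>I. W i \<omega> \<in> B i} = (\<Prod>i\<in>I. p i (B i))"
    if "\<And>i. i \<in> I \<Longrightarrow> B i \<in> sets borel" for B
  proof -
    have "(\<Prod>i\<in>I. p i (B i)) = (\<Prod>i\<in>I. \<integral>\<^sup>+w. g i w * indicator (B i) w \<partial>lborel) / (\<Prod>i\<in>I. c i)"
      unfolding p_def using fin c0 ct
      by (intro prod_divide_ennreal) auto
    then show ?thesis using formula[of B] that Z by simp
  qed
  have joint: "emeasure M {\<omega>\<in>space M. \<forall>i\<in>J. W i \<omega> \<in> B i} = (\<Prod>i\<in>J. p i (B i))"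
    if J: "J \<subseteq> I" and B: "\<And>i. i \<in> J \<Longrightarrow> B i \<in> sets borel" for J B
  proof -
    let ?B = "\<lambda>i. if i \<in> J then B i else UNIV"
    have "{\<omega>\<in>space M. \<forall>i\<in>J. W i \<omega> \<in> B i} = {\<omega>\<in>space M. \<forall>i\<in>I. W i \<omega> \<in> ?B i}"
      using J by auto
    also have "emeasure M \<dots> = (\<Prod>i\<in>I. p i (?B i))"
      using B by (intro formula') auto
    also have "\<dots> = (\<Prod>i\<in>J. p i (?B i))"
      using J fin p_UNIV by (intro prod.mono_neutral_right) auto
    also have "\<dots> = (\<Prod>i\<in>J. p i (B i))" by simp
    finally show ?thesis .
  qed
  have single: "emeasure M (W i -` B \<inter> space M) = p i B" if "i \<in> I" "B \<in> sets borel" for i B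
  proof -
    have "W i -` B \<inter> space M = {\<omega>\<in>space M. \<forall>i\<in>{i}. W i \<omega> \<in> B}" by auto
    then show ?thesis using joint[of "{i}" "\<lambda>_. B"] that by simp
  qed
  show "indep_vars (\<lambda>_. borel) W I"
    unfolding indep_vars_def2
  proof (intro conjI ballI indep_setsI)
    fix A J
    assume J: "J \<noteq> {}" "J \<subseteq> I" "finite J"
      and A: "\<forall>j\<in>J. A j \<in> {W j -` B \<inter> space M |B. B \<in> sets borel}"
    then obtain B where B: "\<And>j. j \<in> J \<Longrightarrow> A j = W j -` B j \<inter> space M \<and> B j \<in> sets borel"
      by (auto simp: Ball_def) metis
    have "(\<Inter>j\<in>J. A j) = {\<omega>\<in>space M. \<forall>i\<in>J. W i \<omega> \<in> B i}"
      using J B by auto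
    then have "emeasure M (\<Inter>j\<in>J. A j) = (\<Prod>j\<in>J. p j (B j))"
      using joint[of J B] J B by simp
    also have "\<dots> = (\<Prod>j\<in>J. emeasure M (A j))"
      using B J single by (intro prod.cong) auto
    finally show "prob (\<Inter>j\<in>J. A j) = (\<Prod>j\<in>J. prob (A j))"
      by (simp add: emeasure_eq_measure prod_ennreal prod_nonneg)
  qed (use W in \<open>auto intro: measurable_sets\<close>)
  fix i assume i: "i \<in> I"
  have "distr M lborel (W i) = density lborel (\<lambda>w. g i w / c i)"
  proof (rule measure_eqI)
    fix B assume "B \<in> sets (distr M lborel (W i))"
    then have B[measurable]: "B \<in> sets borel" by simp
    note [measurable] = g[OF i]
    have "emeasure (density lborel (\<lambda>w. g i w / c i)) B = (\<integral>\<^sup>+w. g i w * indicator B w / c i \<partial>lborel)"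
      by (subst emeasure_density)
        (auto intro!: nn_integral_cong simp: divide_ennreal_def ac_simps)
    also have "\<dots> = p i B" by (simp add: p_def nn_integral_divide)
    finally show "emeasure (distr M lborel (W i)) B = emeasure (density lborel (\<lambda>w. g i w / c i)) B"
      using single[OF i B] W[OF i] by (simp add: emeasure_distr)
  qed simp
  then show "distributed M lborel (W i) (\<lambda>w. g i w / (\<integral>\<^sup>+w. g i w \<partial>lborel))"
    using W[OF i] g[OF i] by (simp add: distributed_def c_def)
qed

lemma nn_integral_powr_rescale:
  fixes c a :: real and h :: "real \<Rightarrow> ennreal"
  assumes c: "0 < c" and R[measurable]: "R \<in> sets borel" and R_pos: "R \<subseteq> {0<..}"
    and h[measurable]: "h \<in> borel_measurable borel"
  shows "(\<integral>\<^sup>+t. ennreal (t powr (a - 1)) * h (t / c) * indicator R (t / c) \<partial>lborel) =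
    ennreal (c powr a) * (\<integral>\<^sup>+w. ennreal (w powr (a - 1)) * h w * indicator R w \<partial>lborel)"
proof -
  have "(\<integral>\<^sup>+t. ennreal (t powr (a - 1)) * h (t / c) * indicator R (t / c) \<partial>lborel)
      = c * (\<integral>\<^sup>+w. ennreal ((c * w) powr (a - 1)) * h w * indicator R w \<partial>lborel)"
    using c by (subst nn_integral_real_affine[where c = c and t = 0]) auto
  also have "(\<integral>\<^sup>+w. ennreal ((c * w) powr (a - 1)) * h w * indicator R w \<partial>lborel)
      = (\<integral>\<^sup>+w. ennreal (c powr (a - 1)) * (ennreal (w powr (a - 1)) * h w * indicator R w) \<partial>lborel)"
  proof (rule nn_integral_cong)
    fix w :: real
    show "ennreal ((c * w) powr (a - 1)) * h w * indicator R w
        = ennreal (c powr (a - 1)) * (ennreal (w powr (a - 1)) * h w * indicator R w)"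
      using R_pos c by (cases "w \<in> R") (auto simp: powr_mult ennreal_mult ac_simps)
  qed
  also have "\<dots> = ennreal (c powr (a - 1)) * (\<integral>\<^sup>+w. ennreal (w powr (a - 1)) * h w * indicator R w \<partial>lborel)"
    by (rule nn_integral_cmult) measurable
  also have "ennreal c * (ennreal (c powr (a - 1)) * I) = ennreal (c powr a) * I" for I
  proof -
    have "c * c powr (a - 1) = c powr a" using c by (simp add: powr_diff)
    then show ?thesis using c by (simp add: ennreal_mult' flip: mult.assoc ennreal_mult'')
  qed
  finally show ?thesis .
qed

section \<open>Sources and descendant-closed sets of a moral DAG\<close>

locale moral_graph =
  fixes G :: "'v graph" and D :: "'v rel"
  assumes simple: "simple_graph G" and moral: "moral_dag G D"
begin

text \<open>Closure is relative to an ambient set \<open>A\<close>, so that the results also apply to the moral DAG induced on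
an arbitrary set of vertices.\<close>

definition desc_closed :: "'v set \<Rightarrow> 'v set \<Rightarrow> bool" where
  "desc_closed A C \<longleftrightarrow> C \<subseteq> A \<and> D `` C \<inter> A \<subseteq> C"

lemma finite_verts: "finite (verts G)"
  using simple by (simp add: simple_graph_def)

lemma finite_vertex_set: "A \<subseteq> verts G \<Longrightarrow> finite A"
  using finite_verts finite_subset by blast

lemma adj_iff: "(i, j) \<in> adj G \<longleftrightarrow> (i, j) \<in> D \<or> (j, i) \<in> D"
  using moral by (auto simp: moral_dag_def)

lemma D_subset: "D \<subseteq> verts G \<times> verts G"
proof -
  have "D \<subseteq> adj G" using moral by (auto simp: moral_dag_def)
  then show ?thesis using simple by (auto simp: simple_graph_def)
qed

lemma acyclic_D: "acyclic D"
  using moral by (simp add: moral_dag_def)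

lemma wf_D: "wf D"
  using finite_acyclic_wf[OF _ acyclic_D] finite_subset[OF D_subset] finite_verts by blast

lemma de_subset: "de D i \<subseteq> verts G"
  using trancl_subset_Sigma[OF D_subset] by (auto simp: de_def)

lemma children_subset_de: "D `` {i} \<subseteq> de D i"
  by (auto simp: de_def)

lemma not_in_de: "i \<notin> de D i"
  using acyclic_D by (auto simp: de_def acyclic_def)

lemma desc_closed_de: "desc_closed (verts G) (de D i)"
  using de_subset[of i] by (auto simp: desc_closed_def de_def dest: trancl_into_trancl)

lemma desc_closed_refl: "desc_closed A A"
  by (auto simp: desc_closed_def)

lemma de_subset_desc_closed:
  assumes "desc_closed (verts G) C" "i \<in> C"
  shows "de D i \<subseteq> C"
proof
  fix j assume "j \<in> de D i"
  then have "(i, j) \<in> D\<^sup>+" by (simp add: de_def)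
  then show "j \<in> C"
    by (induction rule: trancl_induct)
      (use assms D_subset in \<open>auto simp: desc_closed_def\<close>)
qed

text \<open>A nonempty set has a vertex without a parent in it, since \<open>D\<close> is well-founded; removing this vertex keeps
the set descendant-closed.\<close>

lemma source_cases [consumes 2, case_names empty insert]:
  assumes "desc_closed A C" "A \<subseteq> verts G"
  obtains "C = {}"
  | i B where "C = insert i B" "desc_closed A B" "i \<in> A" "i \<notin> B" "D `` {i} \<inter> A \<subseteq> B"
      "pa D i \<inter> B = {}" "i \<notin> pa D i"
proof (cases "C = {}")
  case False
  then obtain i where i: "i \<in> C" and src: "\<And>j. (j, i) \<in> D \<Longrightarrow> j \<notin> C"
    using wfE_min[OF wf_D] by (metis ex_in_conv)
  have irr: "(i, i) \<notin> D" using src i by blast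
  let ?B = "C - {i}"
  have "desc_closed A ?B" using assms src by (auto simp: desc_closed_def)
  moreover have "D `` {i} \<inter> A \<subseteq> ?B" using assms i irr by (auto simp: desc_closed_def)
  ultimately show thesis
    using assms i src irr by (intro that(2)[of i ?B]) (auto simp: desc_closed_def pa_def)
qed (use that in simp)

lemma source_induct [consumes 2, case_names empty insert]:
  assumes "desc_closed A C" "A \<subseteq> verts G"
    and "P {}"
    and "\<And>i B. \<lbrakk>desc_closed A B; desc_closed A (insert i B); i \<in> A; i \<notin> B; D `` {i} \<inter> A \<subseteq> B;
          pa D i \<inter> insert i B = {}; P B\<rbrakk> \<Longrightarrow> P (insert i B)"
  shows "P C"
proof -
  have "finite C" using assms(1,2) finite_verts
    by (meson desc_closed_def finite_subset)
  then show ?thesis using assms(1)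
  proof (induction C rule: finite_psubset_induct)
    case (psubset C)
    from psubset.prems assms(2) show ?case
    proof (cases rule: source_cases)
      case (insert i B)
      have "B \<subset> C" using insert by auto
      then have "P B" using psubset.IH insert by blast
      then show ?thesis using psubset.prems insert assms(4)[of B i] by auto
    qed (use assms(3) in simp)
  qed
qed

text \<open>This is where morality enters. If a child \<open>k\<close> of some \<open>j \<in> B\<close> were also a child of \<open>i\<close>, then \<open>i\<close> and \<open>j\<close>
would be adjacent as parents of \<open>k\<close>; as \<open>j\<close> is not a parent of \<open>i\<close>, it would be a child.\<close>

lemma desc_closed_minus_children:
  assumes "desc_closed A B" "A \<subseteq> verts G" "i \<notin> B" "pa D i \<inter> B = {}"
  shows "desc_closed A (B - D `` {i})"
  unfolding desc_closed_def
proof (intro conjI subsetI)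
  fix k assume "k \<in> D `` (B - D `` {i}) \<inter> A"
  then obtain j where j: "j \<in> B" "(i, j) \<notin> D" "(j, k) \<in> D" "k \<in> A" by auto
  have "(i, k) \<notin> D"
  proof
    assume "(i, k) \<in> D"
    moreover have "i \<noteq> j" using j assms(3) by auto
    ultimately have "(i, j) \<in> adj G"
      using j moral by (auto simp: moral_dag_def)
    then have "j \<in> pa D i \<inter> B" using j by (auto simp: adj_iff pa_def)
    then show False using assms(4) by simp
  qed
  then show "k \<in> B - D `` {i}" using j assms(1) by (auto simp: desc_closed_def)
qed (use assms in \<open>auto simp: desc_closed_def\<close>)

section \<open>Triangular coordinates\<close>

text \<open>For \<open>s = -1\<close> this is \<open>U\<^sub>i\<close>, for \<open>s = 1\<close> it is \<open>W\<^sub>i\<close>.\<close>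

definition coord :: "real \<Rightarrow> 'v \<Rightarrow> ('v \<Rightarrow> real) \<Rightarrow> real" where
  "coord s i y =
    (delta_on G (de_bar D i) (\<lambda>j. s * y j) / delta_on G (de D i) (\<lambda>j. s * y j) - 1) / s"

text \<open>The parametrisation \<open>y\<^sub>i = u\<^sub>i \<Prod> (1 + s u\<^sub>j)\<close>, with the product over the children of \<open>i\<close>, factorises the
polynomial of every descendant-closed set: adding a source \<open>i\<close> to \<open>B\<close> adds
\<open>s y\<^sub>i delta_{B - ch i}\<close>, whose factors missing over \<open>ch i\<close> are supplied by \<open>y\<^sub>i\<close>, so \<open>delta_B\<close> is
multiplied by \<open>1 + s u\<^sub>i\<close>.\<close>

lemma delta_on_eq_prod:
  assumes "desc_closed A C" "A \<subseteq> verts G"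
    and "\<And>i. i \<in> C \<Longrightarrow> y i = u i * (\<Prod>j\<in>D `` {i} \<inter> A. 1 + s * u j)"
  shows "delta_on G C (\<lambda>i. s * y i) = (\<Prod>i\<in>C. 1 + s * u i)"
proof -
  have "\<forall>E. desc_closed A E \<longrightarrow> E \<subseteq> C \<longrightarrow>
      delta_on G E (\<lambda>i. s * y i) = (\<Prod>i\<in>E. 1 + s * u i)"
  proof (intro allI impI)
    fix E assume "desc_closed A E" "E \<subseteq> C"
    then have "finite E" using assms(2) by (meson desc_closed_def finite_vertex_set subset_trans)
    then show "delta_on G E (\<lambda>i. s * y i) = (\<Prod>i\<in>E. 1 + s * u i)"
      using \<open>desc_closed A E\<close> \<open>E \<subseteq> C\<close>
    proof (induction E rule: finite_psubset_induct)
      case (psubset E)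
      note IH = psubset.IH and EC = psubset.prems(2)
      from psubset.prems(1) assms(2)
      show ?case using IH EC
      proof (cases rule: source_cases)
        case empty
        then show ?thesis by (simp add: delta_on_empty)
      next
        case (insert i B)
        let ?ch = "D `` {i}"
        let ?p = "\<lambda>F. \<Prod>j\<in>F. 1 + s * u j"
        have fin: "finite B" using insert assms(2)
          by (meson desc_closed_def finite_vertex_set subset_trans)
        have *: "B - adj G `` {i} = B - ?ch"
          using insert by (auto simp: adj_iff pa_def)
        have "?p B = ?p (?ch \<inter> A) * ?p (B - ?ch)"
        proof -
          have "B = (?ch \<inter> A) \<union> (B - ?ch)"
            using insert by (auto simp: desc_closed_def)
          then have "?p B = ?p ((?ch \<inter> A) \<union> (B - ?ch))" by simp
          also have "\<dots> = ?p (?ch \<inter> A) * ?p (B - ?ch)"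
            using fin insert finite_subset by (intro prod.union_disjoint) auto
          finally show ?thesis .
        qed
        moreover have "delta_on G B (\<lambda>i. s * y i) = ?p B"
          using IH[of B] insert EC by auto
        moreover have "delta_on G (B - ?ch) (\<lambda>i. s * y i) = ?p (B - ?ch)"
          using IH[of "B - ?ch"] insert EC
            desc_closed_minus_children[of A B i] assms(2) by auto
        moreover have "y i = u i * ?p (?ch \<inter> A)" using insert EC assms(3) by auto
        ultimately show ?thesis
          unfolding \<open>E = insert i B\<close> using fin insert simple
          by (simp add: delta_on_insert * algebra_simps)
      qed
    qed
  qed
  then show ?thesis using assms(1) by blast
qed

text \<open>Given the parametrisation on the descendants of \<open>i\<close>, the lemma \<open>delta_on_eq_prod\<close> turns both
\<open>delta_{de i}\<close> and \<open>delta_{de i - ch i}\<close> into products, and their quotient is the product over \<open>ch i\<close>.\<close>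

lemma coord_eq:
  assumes "s \<noteq> 0" "i \<in> verts G" "\<And>j. j \<in> de D i \<Longrightarrow> 0 < 1 + s * coord s j y"
    and rec: "\<And>j. j \<in> de D i \<Longrightarrow> y j = coord s j y * (\<Prod>k\<in>D `` {j}. 1 + s * coord s k y)"
  shows "coord s i y * (\<Prod>j\<in>D `` {i}. 1 + s * coord s j y) = y i"
proof -
  let ?ch = "D `` {i}"
  let ?p = "\<lambda>F. \<Prod>j\<in>F. 1 + s * coord s j y"
  let ?d = "\<lambda>F. delta_on G F (\<lambda>j. s * y j)"
  have fin: "finite (de D i)" using de_subset finite_vertex_set by blast
  have sub: "D `` {j} \<inter> verts G = D `` {j}" for j using D_subset by auto
  have pa_de: "pa D i \<inter> de D i = {}"
    using not_in_de[of i] by (auto simp: pa_def de_def dest: trancl_into_trancl)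
  have *: "de D i - adj G `` {i} = de D i - ?ch"
    using pa_de by (auto simp: adj_iff pa_def)
  have 1: "?d (de D i) = ?p (de D i)"
    by (rule delta_on_eq_prod[OF desc_closed_de]) (use rec sub in auto)
  have 2: "?d (de D i - ?ch) = ?p (de D i - ?ch)"
    by (rule delta_on_eq_prod[OF desc_closed_minus_children[OF desc_closed_de]])
      (use rec sub pa_de not_in_de in auto)
  have 3: "?p (de D i) = ?p ?ch * ?p (de D i - ?ch)"
    using prod.subset_diff[OF children_subset_de fin] by (simp add: mult.commute)
  have pos: "?p ?ch > 0" "?p (de D i - ?ch) > 0"
    using assms(3) children_subset_de by (auto intro!: prod_pos)
  have "?d (de_bar D i) = ?d (de D i) + s * y i * ?d (de D i - ?ch)"
    using delta_on_insert[OF simple fin not_in_de] by (simp add: de_bar_def *)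
  then have "coord s i y = y i / ?p ?ch"
    unfolding coord_def[of s i] using pos assms(1) by (simp add: 1 2 3 field_simps)
  then show ?thesis using pos by simp
qed

lemma coord_recursion:
  assumes "s \<noteq> 0" "desc_closed (verts G) C" "\<And>j. j \<in> C \<Longrightarrow> 0 < 1 + s * coord s j y"
  shows "\<forall>i\<in>C. coord s i y * (\<Prod>j\<in>D `` {i}. 1 + s * coord s j y) = y i"
  using assms(2) subset_refl assms(3)
proof (induction rule: source_induct)
  case (insert i B)
  have B: "\<forall>j\<in>B. coord s j y * (\<Prod>k\<in>D `` {j}. 1 + s * coord s k y) = y j"
    using insert by blast
  have de: "de D i \<subseteq> B" using de_subset_desc_closed[OF insert(2), of i] not_in_de by auto
  have "coord s i y * (\<Prod>j\<in>D `` {i}. 1 + s * coord s j y) = y i"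
    using assms(1) insert.hyps(3) by (rule coord_eq) (use de B insert.prems in auto)
  then show ?case using B by blast
qed simp

text \<open>Coordinates relative to the DAG induced on \<open>A\<close> can be constructed by adding one source at a time. For
\<open>s < 0\<close> smaller coordinates \<open>v\<close> on the children make the factor \<open>\<Prod> (1 + s v\<^sub>j)\<close> larger, so the new
coordinate \<open>v\<^sub>i\<close>, the quotient of \<open>y\<^sub>i\<close> by this factor, stays below \<open>u\<^sub>i\<close> as well.\<close>

lemma smaller_coordinates:
  fixes s :: real and u y :: "'v \<Rightarrow> real"
  assumes "A \<subseteq> verts G" "s < 0"
    and u: "\<And>i. i \<in> A \<Longrightarrow> 0 < 1 + s * u i"
    and y: "\<And>i. i \<in> A \<Longrightarrow> 0 \<le> y i" "\<And>i. i \<in> A \<Longrightarrow> y i \<le> u i * (\<Prod>j\<in>D `` {i} \<inter> A. 1 + s * u j)"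
  shows "\<exists>v. \<forall>i\<in>A. v i \<le> u i \<and> y i = v i * (\<Prod>j\<in>D `` {i} \<inter> A. 1 + s * v j)"
proof -
  have "\<exists>v. \<forall>i\<in>C. v i \<le> u i \<and> y i = v i * (\<Prod>j\<in>D `` {i} \<inter> A. 1 + s * v j)"
    if "desc_closed A C" for C
    using that assms(1)
  proof (induction rule: source_induct)
    case (insert i B)
    from insert.IH obtain v where v: "\<forall>j\<in>B. v j \<le> u j \<and> y j = v j * (\<Prod>k\<in>D `` {j} \<inter> A. 1 + s * v k)" ..
    let ?p = "\<lambda>v. \<Prod>j\<in>D `` {i} \<inter> A. 1 + s * v j"
    have ch: "D `` {i} \<inter> A \<subseteq> B" using insert by simp
    have pu: "0 < ?p u" by (rule prod_pos) (use u in auto)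
    have le: "?p u \<le> ?p v"
    proof (rule prod_mono, intro conjI)
      fix j assume j: "j \<in> D `` {i} \<inter> A"
      then show "0 \<le> 1 + s * u j" using u by (auto simp: less_imp_le)
      have "v j \<le> u j" using v ch j by blast
      then show "1 + s * u j \<le> 1 + s * v j" using \<open>s < 0\<close> by (simp add: mult_left_mono_neg)
    qed
    have pv: "0 < ?p v" using pu le by linarith
    have yi_le: "y i \<le> u i * ?p u" and yi0: "0 \<le> y i" using y \<open>i \<in> A\<close> by auto
    have "0 \<le> u i"
    proof (rule ccontr)
      assume "\<not> 0 \<le> u i"
      then have "u i * ?p u < 0" using pu by (simp add: mult_neg_pos)
      then show False using yi_le yi0 by linarith
    qed
    then have "y i \<le> u i * ?p v" using yi_le mult_left_mono[OF le] by (meson order_trans)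
    then have yi: "y i / ?p v \<le> u i" using pv by (simp add: pos_divide_le_eq)
    let ?v = "v(i := y i / ?p v)"
    have same: "(\<Prod>k\<in>D `` {j} \<inter> A. 1 + s * ?v k) = (\<Prod>k\<in>D `` {j} \<inter> A. 1 + s * v k)"
      if "j \<in> insert i B" for j
    proof (rule prod.cong)
      fix k assume "k \<in> D `` {j} \<inter> A"
      then have "k \<noteq> i" using insert.hyps that by (auto simp: pa_def)
      then show "1 + s * ?v k = 1 + s * v k" by simp
    qed simp
    have new: "?v j \<le> u j \<and> y j = ?v j * (\<Prod>k\<in>D `` {j} \<inter> A. 1 + s * v k)"
      if "j \<in> insert i B" for j
    proof (cases "j = i")
      case True
      then show ?thesis using yi pv by simp
    next
      case False
      then show ?thesis using v that by simp
    qed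
    have "\<forall>j\<in>insert i B. ?v j \<le> u j \<and> y j = ?v j * (\<Prod>k\<in>D `` {j} \<inter> A. 1 + s * ?v k)"
    proof
      fix j assume j: "j \<in> insert i B"
      show "?v j \<le> u j \<and> y j = ?v j * (\<Prod>k\<in>D `` {j} \<inter> A. 1 + s * ?v k)"
        unfolding same[OF j] by (rule new[OF j])
    qed
    then show ?case by (rule exI[where x = ?v])
  qed simp
  then show ?thesis using desc_closed_refl .
qed

text \<open>For \<open>s > 0\<close> all terms of the polynomial are nonnegative and the one of the empty set is \<open>1\<close>. For \<open>s < 0\<close>,
discarding the children outside \<open>A\<close> removes factors at most \<open>1\<close>, so \<open>smaller_coordinates\<close> applies to \<open>A\<close>
and the polynomial of \<open>A\<close> is a product of positive factors.\<close>

lemma delta_on_pos_of_coordinates: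
  assumes "s \<noteq> 0" and A: "A \<subseteq> verts G"
    and y_pos: "\<And>i. i \<in> verts G \<Longrightarrow> 0 < y i" and u_pos: "\<And>i. i \<in> verts G \<Longrightarrow> 0 < u i"
    and u: "\<And>i. i \<in> verts G \<Longrightarrow> 0 < 1 + s * u i"
    and y: "\<And>i. i \<in> verts G \<Longrightarrow> y i = u i * (\<Prod>j\<in>D `` {i}. 1 + s * u j)"
  shows "0 < delta_on G A (\<lambda>i. s * y i)"
proof -
  consider "s > 0" | "s < 0" using assms(1) by linarith
  then show ?thesis
  proof cases
    case 1
    then show ?thesis using assms finite_vertex_set by (auto intro!: delta_on_pos)
  next
    case 2
    have "y i \<le> u i * (\<Prod>j\<in>D `` {i} \<inter> A. 1 + s * u j)" if "i \<in> A" for i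
    proof -
      have sub: "D `` {i} \<subseteq> verts G" using D_subset by auto
      have fin: "finite (D `` {i})" using finite_vertex_set[OF sub] .
      have le1: "(\<Prod>j\<in>D `` {i} - A. 1 + s * u j) \<le> 1"
        using sub u u_pos 2
        by (intro prod_le_1) (auto simp: less_imp_le mult_nonpos_nonneg subset_iff)
      have nn: "0 \<le> (\<Prod>j\<in>D `` {i} \<inter> A. 1 + s * u j)"
        using sub u by (intro prod_nonneg) (auto simp: less_imp_le subset_iff)
      have "(\<Prod>j\<in>D `` {i}. 1 + s * u j)
          = (\<Prod>j\<in>D `` {i} - A. 1 + s * u j) * (\<Prod>j\<in>D `` {i} \<inter> A. 1 + s * u j)"
        using fin by (subst prod.Int_Diff[OF fin, of _ A]) simp
      also have "\<dots> \<le> (\<Prod>j\<in>D `` {i} \<inter> A. 1 + s * u j)"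
        using mult_right_mono[OF le1 nn] by simp
      finally have "u i * (\<Prod>j\<in>D `` {i}. 1 + s * u j) \<le> u i * (\<Prod>j\<in>D `` {i} \<inter> A. 1 + s * u j)"
        using A u_pos that by (intro mult_left_mono) (auto intro: less_imp_le)
      then show ?thesis using y[of i] A that by auto
    qed
    then obtain v where v: "\<forall>i\<in>A. v i \<le> u i \<and> y i = v i * (\<Prod>j\<in>D `` {i} \<inter> A. 1 + s * v j)"
      using smaller_coordinates[of A s u y] 2 assms by (auto simp: less_imp_le subset_iff)
    have "delta_on G A (\<lambda>i. s * y i) = (\<Prod>i\<in>A. 1 + s * v i)"
      by (rule delta_on_eq_prod[OF desc_closed_refl A]) (use v in blast)
    also have "\<dots> > 0"
    proof (rule prod_pos)
      fix i assume i: "i \<in> A"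
      then have "s * u i \<le> s * v i" using v 2 by (simp add: mult_left_mono_neg)
      then show "0 < 1 + s * v i" using u[of i] i A by auto
    qed
    finally show ?thesis .
  qed
qed

text \<open>This is \<open>(0,1)\<close> for \<open>s = -1\<close> and \<open>(0,\<infinity>)\<close> for \<open>s = 1\<close>.\<close>

definition coord_range :: "real \<Rightarrow> real set" where
  "coord_range s = {w. 0 < w \<and> 0 < 1 + s * w}"

text \<open>The left-hand side implies the right-hand side by \<open>delta_on_pos_of_coordinates\<close>. Conversely, \<open>w\<^sub>i\<close> and
\<open>1 + s w\<^sub>i\<close> are quotients of positive polynomials, the first one times \<open>y\<^sub>i\<close>.\<close>

lemma coord_range_iff_delta_on_pos:
  assumes "s \<noteq> 0"
  shows "(\<forall>i\<in>verts G. coord s i y \<in> coord_range s) \<longleftrightarrow>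
    (\<forall>i\<in>verts G. 0 < y i) \<and> (\<forall>A. A \<subseteq> verts G \<longrightarrow> 0 < delta_on G A (\<lambda>i. s * y i))"
    (is "?L \<longleftrightarrow> ?R")
proof
  assume L: ?L
  then have rec: "\<forall>i\<in>verts G. coord s i y * (\<Prod>j\<in>D `` {i}. 1 + s * coord s j y) = y i"
    by (intro coord_recursion[OF assms desc_closed_refl]) (simp add: coord_range_def)
  have pos: "0 < y i" if "i \<in> verts G" for i
  proof -
    have "0 < (\<Prod>j\<in>D `` {i}. 1 + s * coord s j y)"
      using L D_subset by (intro prod_pos) (auto simp: coord_range_def)
    then show ?thesis
      using L that bspec[OF rec that, symmetric] by (simp only:) (simp add: coord_range_def)
  qed
  have "0 < delta_on G A (\<lambda>i. s * y i)" if "A \<subseteq> verts G" for A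
  proof (rule delta_on_pos_of_coordinates[OF assms that pos, where u = "\<lambda>i. coord s i y"])
    fix i assume i: "i \<in> verts G"
    show "y i = coord s i y * (\<Prod>j\<in>D `` {i}. 1 + s * coord s j y)" using rec i by simp
    show "0 < coord s i y" "0 < 1 + s * coord s i y" using L i by (simp_all add: coord_range_def)
  qed
  then show ?R using pos by blast
next
  assume R: ?R
  show ?L
  proof
    fix i assume i: "i \<in> verts G"
    have debar: "de_bar D i \<subseteq> verts G" using i de_subset[of i] by (auto simp: de_bar_def)
    have fin: "finite (de D i)" using de_subset finite_vertex_set by blast
    let ?d = "\<lambda>F. delta_on G F (\<lambda>j. s * y j)"
    have pos: "0 < ?d (de_bar D i)" "0 < ?d (de D i)" "0 < ?d (de D i - adj G `` {i})"
      using R debar de_subset[of i] by (blast intro: order_trans[OF Diff_subset])+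
    have "?d (de_bar D i) = ?d (de D i) + s * y i * ?d (de D i - adj G `` {i})"
      using delta_on_insert[OF simple fin not_in_de] by (simp add: de_bar_def)
    then have "coord s i y = y i * ?d (de D i - adj G `` {i}) / ?d (de D i)"
      unfolding coord_def using pos assms by (simp add: field_simps)
    moreover have "1 + s * coord s i y = ?d (de_bar D i) / ?d (de D i)"
      unfolding coord_def using assms by simp
    ultimately show "coord s i y \<in> coord_range s"
      using pos R i by (simp add: coord_range_def)
  qed
qed

section \<open>Integration in triangular coordinates\<close>

lemma measurable_coord [measurable]:
  assumes "de_bar D i \<subseteq> A"
  shows "coord s i \<in> borel_measurable (\<Pi>\<^sub>M i\<in>A. lborel)"
proof -
  have "de D i \<subseteq> A" using assms by (auto simp: de_bar_def)
  then show ?thesis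
    unfolding coord_def
    using measurable_delta_on[OF assms, of G s] measurable_delta_on[of "de D i" A G s] by measurable
qed

text \<open>The coordinate of \<open>j\<close> depends only on the values of \<open>y\<close> at \<open>j\<close> and its descendants, which makes the
change of variables triangular.\<close>

lemma coord_fun_upd:
  assumes "i \<notin> de_bar D j"
  shows "coord s j (y(i := t)) = coord s j y"
proof -
  have "delta_on G F (\<lambda>k. s * (y(i := t)) k) = delta_on G F (\<lambda>k. s * y k)" if "F \<subseteq> de_bar D j" for F
    using that assms by (intro delta_on_cong) auto
  from this[of "de_bar D j"] this[of "de D j"] show ?thesis
    unfolding coord_def by (auto simp: de_bar_def)
qed

lemma coord_range_measurable [measurable]: "coord_range s \<in> sets borel"
  unfolding coord_range_def by measurable

text \<open>The weights \<open>h\<close> are arbitrary because the induction changes them: integrating out the source \<open>i\<close>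
produces the power \<open>\<alpha> i\<close> of \<open>\<Prod> (1 + s w\<^sub>j)\<close> over the children \<open>j\<close> of \<open>i\<close>, which is absorbed into
their weights.\<close>

lemma nn_integral_coord:
  fixes h :: "'v \<Rightarrow> real \<Rightarrow> ennreal"
  assumes "s \<noteq> 0" and "desc_closed (verts G) A"
    and "\<And>j. j \<in> A \<Longrightarrow> h j \<in> borel_measurable borel"
  shows "(\<integral>\<^sup>+y. (\<Prod>j\<in>A. ennreal (y j powr (\<alpha> j - 1)) * h j (coord s j y) *
            indicator (coord_range s) (coord s j y)) \<partial>(\<Pi>\<^sub>M j\<in>A. lborel)) =
    (\<Prod>j\<in>A. \<integral>\<^sup>+w. ennreal (w powr (\<alpha> j - 1)) * h j w *
            ennreal ((1 + s * w) powr (\<Sum>k\<in>pa D j \<inter> A. \<alpha> k)) * indicator (coord_range s) w \<partial>lborel)"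
  using assms(2) subset_refl assms(3)
proof (induction arbitrary: h rule: source_induct)
  case empty
  then show ?case by (simp add: PiM_empty nn_integral_count_space_finite)
next
  case (insert i B)
  interpret product_sigma_finite "\<lambda>_. lborel" ..
  let ?R = "coord_range s"
  let ?ch = "D `` {i}"
  let ?term = "\<lambda>h j y. ennreal (y j powr (\<alpha> j - 1)) * h j (coord s j y) * indicator ?R (coord s j y)"
  \<comment> \<open>The weights after the source \<open>i\<close> has been integrated out.\<close>
  define h' where
    "h' j = (\<lambda>w. h j w * (if j \<in> ?ch then ennreal ((1 + s * w) powr \<alpha> i) else 1))" for j
  define K where "K = (\<integral>\<^sup>+w. ennreal (w powr (\<alpha> i - 1)) * h i w * indicator ?R w \<partial>lborel)"
  have fin: "finite B" using insert.hyps(1) finite_vertex_set by (simp add: desc_closed_def)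
  have ch: "?ch \<subseteq> B" using insert.hyps D_subset by auto
  have debar: "de_bar D j \<subseteq> insert i B" if "j \<in> insert i B" for j
    using de_subset_desc_closed[OF insert.hyps(2) that] that by (auto simp: de_bar_def)
  have debar_B: "de_bar D j \<subseteq> B" if "j \<in> B" for j
    using de_subset_desc_closed[OF insert.hyps(1) that] that by (auto simp: de_bar_def)
  have de_i: "de D i \<subseteq> B" using debar[of i] not_in_de[of i] by (auto simp: de_bar_def)
  have meas_term: "?term h j \<in> borel_measurable (\<Pi>\<^sub>M j\<in>insert i B. lborel)" if j: "j \<in> insert i B" for j
  proof -
    note [measurable] = measurable_coord[OF debar[OF j]] insert.prems[OF j]
    have [measurable]: "(\<lambda>y. y j) \<in> borel_measurable (\<Pi>\<^sub>M j\<in>insert i B. lborel)"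
      using measurable_component_singleton[OF j, of "\<lambda>_. lborel"] by simp
    show ?thesis by measurable
  qed
  have inner: "(\<integral>\<^sup>+t. (\<Prod>j\<in>insert i B. ?term h j (x(i := t))) \<partial>lborel) = K * (\<Prod>j\<in>B. ?term h' j x)" for x
  proof -
    have same: "coord s j (x(i := t)) = coord s j x" if "j \<in> B" for j t
      using debar_B[OF that] insert.hyps(4) by (intro coord_fun_upd) auto
    have old: "?term h j (x(i := t)) = ?term h j x" if "j \<in> B" for j t
      using that insert.hyps(4) by (simp only: same) auto
    have "(\<integral>\<^sup>+t. (\<Prod>j\<in>insert i B. ?term h j (x(i := t))) \<partial>lborel)
        = (\<integral>\<^sup>+t. (\<Prod>j\<in>B. ?term h j x) * ?term h i (x(i := t)) \<partial>lborel)"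
      unfolding prod.insert[OF fin insert.hyps(4)]
      by (subst mult.commute) (intro nn_integral_cong arg_cong2[where f = "(*)"] prod.cong refl old)
    also have "\<dots> = K * (\<Prod>j\<in>B. ?term h' j x)"
    proof (cases "\<forall>j\<in>B. coord s j x \<in> ?R")
      case False
      then have "(\<Prod>j\<in>B. ?term h j x) = 0" "(\<Prod>j\<in>B. ?term h' j x) = 0"
        using fin by (auto intro!: prod_zero simp: indicator_eq_0_iff)
      then show ?thesis by (simp only:) simp
    next
      case True
      define c where "c = (\<Prod>j\<in>?ch. 1 + s * coord s j x)"
      have pos: "0 < 1 + s * coord s j x" if "j \<in> B" for j
        using True that by (simp add: coord_range_def)
      have c: "0 < c" unfolding c_def using ch pos by (intro prod_pos) auto
      have coord_i: "coord s i (x(i := t)) = t / c" for t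
      proof -
        let ?y = "x(i := t)"
        have rec: "\<forall>j\<in>B. coord s j ?y * (\<Prod>k\<in>D `` {j}. 1 + s * coord s k ?y) = ?y j"
          using assms(1) insert.hyps(1) by (rule coord_recursion) (simp add: same pos)
        have "coord s i ?y * (\<Prod>j\<in>?ch. 1 + s * coord s j ?y) = ?y i"
        proof (rule coord_eq[OF assms(1) insert.hyps(3)])
          fix j assume "j \<in> de D i"
          then have j: "j \<in> B" using de_i by blast
          show "0 < 1 + s * coord s j ?y" using same pos j by simp
          show "?y j = coord s j ?y * (\<Prod>k\<in>D `` {j}. 1 + s * coord s k ?y)" using rec j by simp
        qed
        moreover have "(\<Prod>j\<in>?ch. 1 + s * coord s j ?y) = c"
          unfolding c_def using ch same by (intro prod.cong) auto
        ultimately show ?thesis using c by (simp add: field_simps)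
      qed
      note [measurable] = insert.prems[of i, simplified]
      have "(\<integral>\<^sup>+t. ?term h i (x(i := t)) \<partial>lborel) = ennreal (c powr \<alpha> i) * K"
        unfolding coord_i K_def fun_upd_same
        by (rule nn_integral_powr_rescale[OF c]) (auto simp: coord_range_def)
      moreover have "(\<lambda>t. ?term h i (x(i := t))) \<in> borel_measurable lborel"
        unfolding coord_i by simp
      ultimately have "(\<integral>\<^sup>+t. (\<Prod>j\<in>B. ?term h j x) * ?term h i (x(i := t)) \<partial>lborel)
          = (\<Prod>j\<in>B. ?term h j x) * (ennreal (c powr \<alpha> i) * K)"
        by (simp only: nn_integral_cmult)
      also have "ennreal (c powr \<alpha> i)
          = (\<Prod>j\<in>B. if j \<in> ?ch then ennreal ((1 + s * coord s j x) powr \<alpha> i) else 1)"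
      proof -
        have "c powr \<alpha> i = (\<Prod>j\<in>?ch. (1 + s * coord s j x) powr \<alpha> i)"
          unfolding c_def by (rule prod_powr_distrib)
        also have "ennreal \<dots> = (\<Prod>j\<in>?ch. ennreal ((1 + s * coord s j x) powr \<alpha> i))"
          by (simp add: prod_ennreal)
        also have "\<dots> = (\<Prod>j\<in>B. if j \<in> ?ch then ennreal ((1 + s * coord s j x) powr \<alpha> i) else 1)"
          by (subst prod.inter_restrict[OF fin, symmetric]) (use ch in \<open>simp add: Int_absorb1\<close>)
        finally show ?thesis .
      qed
      also have "(\<Prod>j\<in>B. ?term h j x) *
            ((\<Prod>j\<in>B. if j \<in> ?ch then ennreal ((1 + s * coord s j x) powr \<alpha> i) else 1) * K)
          = K * (\<Prod>j\<in>B. ?term h' j x)"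
        by (simp only: h'_def prod.distrib ac_simps)
      finally show ?thesis .
    qed
    finally show ?thesis .
  qed
  have h'_meas: "h' j \<in> borel_measurable borel" if "j \<in> B" for j
  proof -
    note [measurable] = insert.prems[of j]
    show ?thesis using that unfolding h'_def by (cases "j \<in> ?ch") auto
  qed
  have weight: "(\<integral>\<^sup>+w. ennreal (w powr (\<alpha> j - 1)) * h' j w *
        ennreal ((1 + s * w) powr (\<Sum>k\<in>pa D j \<inter> B. \<alpha> k)) * indicator ?R w \<partial>lborel)
      = (\<integral>\<^sup>+w. ennreal (w powr (\<alpha> j - 1)) * h j w *
        ennreal ((1 + s * w) powr (\<Sum>k\<in>pa D j \<inter> insert i B. \<alpha> k)) * indicator ?R w \<partial>lborel)"
    if "j \<in> B" for j
  proof (cases "j \<in> ?ch")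
    case True
    then have "pa D j \<inter> insert i B = insert i (pa D j \<inter> B)" by (auto simp: pa_def)
    then have "(\<Sum>k\<in>pa D j \<inter> insert i B. \<alpha> k) = \<alpha> i + (\<Sum>k\<in>pa D j \<inter> B. \<alpha> k)"
      using fin insert.hyps(4) by simp
    then show ?thesis using True
      by (intro nn_integral_cong)
        (simp add: h'_def powr_add ennreal_mult ac_simps)
  next
    case False
    then have "pa D j \<inter> insert i B = pa D j \<inter> B" by (auto simp: pa_def)
    then show ?thesis using False by (simp add: h'_def)
  qed
  have "(\<integral>\<^sup>+y. (\<Prod>j\<in>insert i B. ?term h j y) \<partial>(\<Pi>\<^sub>M j\<in>insert i B. lborel))
      = (\<integral>\<^sup>+x. (\<integral>\<^sup>+t. (\<Prod>j\<in>insert i B. ?term h j (x(i := t))) \<partial>lborel) \<partial>(\<Pi>\<^sub>M j\<in>B. lborel))"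
    using fin insert.hyps(4) by (rule product_nn_integral_insert) (use meas_term in measurable)
  also have "\<dots> = (\<integral>\<^sup>+x. K * (\<Prod>j\<in>B. ?term h' j x) \<partial>(\<Pi>\<^sub>M j\<in>B. lborel))"
    unfolding inner ..
  also have "\<dots> = K * (\<integral>\<^sup>+x. (\<Prod>j\<in>B. ?term h' j x) \<partial>(\<Pi>\<^sub>M j\<in>B. lborel))"
  proof (rule nn_integral_cmult, rule borel_measurable_prod_ennreal)
    fix j assume j: "j \<in> B"
    note [measurable] = measurable_coord[OF debar_B[OF j]] h'_meas[OF j]
    have [measurable]: "(\<lambda>y. y j) \<in> borel_measurable (\<Pi>\<^sub>M j\<in>B. lborel)"
      using measurable_component_singleton[OF j, of "\<lambda>_. lborel"] by simp
    show "?term h' j \<in> borel_measurable (\<Pi>\<^sub>M j\<in>B. lborel)" by measurable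
  qed
  also have "(\<integral>\<^sup>+x. (\<Prod>j\<in>B. ?term h' j x) \<partial>(\<Pi>\<^sub>M j\<in>B. lborel))
      = (\<Prod>j\<in>B. \<integral>\<^sup>+w. ennreal (w powr (\<alpha> j - 1)) * h' j w *
          ennreal ((1 + s * w) powr (\<Sum>k\<in>pa D j \<inter> B. \<alpha> k)) * indicator ?R w \<partial>lborel)"
    by (rule insert.IH) (rule h'_meas)
  also have "K = (\<integral>\<^sup>+w. ennreal (w powr (\<alpha> i - 1)) * h i w *
          ennreal ((1 + s * w) powr (\<Sum>k\<in>pa D i \<inter> insert i B. \<alpha> k)) * indicator ?R w \<partial>lborel)"
    unfolding K_def insert.hyps(6)
    by (intro nn_integral_cong) (auto simp: coord_range_def indicator_def)
  finally show ?case
    using fin insert.hyps(4) by (simp add: weight cong: prod.cong)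
qed

section \<open>The law of the coordinates\<close>

lemma induced_verts: "induced G (verts G) = G"
  using simple by (intro graph.equality) (auto simp: induced_def simple_graph_def)

text \<open>For \<open>s = -1\<close> this is \<open>M_set G\<close>; for \<open>s = 1\<close> the polynomials have positive terms and it is the whole
positive orthant.\<close>

definition coord_support :: "real \<Rightarrow> ('v \<Rightarrow> real) set" where
  "coord_support s =
    {y \<in> pos_orthant G. \<forall>A. A \<subseteq> verts G \<longrightarrow> 0 < delta_on G A (\<lambda>i. s * y i)}"

lemma coord_support_iff:
  assumes "s \<noteq> 0" "y \<in> space (lebesgue_on_verts G)"
  shows "y \<in> coord_support s \<longleftrightarrow> (\<forall>i\<in>verts G. coord s i y \<in> coord_range s)"
  using assms(2) coord_range_iff_delta_on_pos[OF assms(1), of y]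
  by (auto simp: coord_support_def pos_orthant_def lebesgue_on_verts_def space_PiM PiE_iff)

lemma delta_on_verts_eq_prod_coord:
  assumes "s \<noteq> 0" and coord: "\<And>i. i \<in> verts G \<Longrightarrow> coord s i y \<in> coord_range s"
  shows "delta_on G (verts G) (\<lambda>i. s * y i) = (\<Prod>i\<in>verts G. 1 + s * coord s i y)"
proof (rule delta_on_eq_prod[OF desc_closed_refl subset_refl])
  fix i assume i: "i \<in> verts G"
  have "D `` {i} \<inter> verts G = D `` {i}" using D_subset by auto
  moreover have "\<forall>i\<in>verts G. coord s i y * (\<Prod>j\<in>D `` {i}. 1 + s * coord s j y) = y i"
    using assms(1) desc_closed_refl by (rule coord_recursion) (use coord in \<open>simp add: coord_range_def\<close>)
  ultimately show "y i = coord s i y * (\<Prod>j\<in>D `` {i} \<inter> verts G. 1 + s * coord s j y)"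
    using i by simp
qed

text \<open>On the support, \<open>delta\<close> of the whole graph is \<open>\<Prod> (1 + s w\<^sub>i)\<close>, so its power \<open>b\<close> and the
indicators of the events \<open>w\<^sub>i \<in> B\<^sub>i\<close> are weights of the form allowed in \<open>nn_integral_coord\<close>.\<close>

lemma coord_independent_and_distributed:
  fixes M :: "'b measure" and X :: "'b \<Rightarrow> 'v \<Rightarrow> real" and \<alpha> :: "'v \<Rightarrow> real" and b s :: real
  defines "f \<equiv> \<lambda>y. delta_on G (verts G) (\<lambda>i. s * y i) powr b *
      (\<Prod>i\<in>verts G. y i powr (\<alpha> i - 1)) * indicator (coord_support s) y"
  assumes s: "s \<noteq> 0" and "prob_space M"
    and X: "distributed M (lebesgue_on_verts G) X (normalized (lebesgue_on_verts G) f)"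
  shows "prob_space.indep_vars M (\<lambda>_. borel) (\<lambda>i \<omega>. coord s i (X \<omega>)) (verts G)"
    and "\<And>i. i \<in> verts G \<Longrightarrow> distributed M lborel (\<lambda>\<omega>. coord s i (X \<omega>))
      (normalized lborel (\<lambda>w. w powr (\<alpha> i - 1) *
        (1 + s * w) powr (b + (\<Sum>k\<in>pa D i. \<alpha> k)) * indicator (coord_range s) w))"
proof -
  interpret prob_space M by fact
  let ?V = "verts G"
  let ?N = "lebesgue_on_verts G"
  let ?R = "coord_range s"
  define Z where "Z = (\<integral>\<^sup>+y. ennreal (f y) \<partial>?N)"
  define g where "g i w = ennreal (w powr (\<alpha> i - 1) *
    (1 + s * w) powr (b + (\<Sum>k\<in>pa D i. \<alpha> k)) * indicator ?R w)" for i w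
  have meas_coord: "coord s i \<in> borel_measurable ?N" if "i \<in> ?V" for i
    unfolding lebesgue_on_verts_def
    using that de_subset[of i] by (intro measurable_coord) (auto simp: de_bar_def)
  have meas_X: "X \<in> M \<rightarrow>\<^sub>M ?N" using X by (rule distributed_measurable)
  have sub: "pa D i \<inter> ?V = pa D i" for i using D_subset by (auto simp: pa_def)
  have meas_W: "(\<lambda>\<omega>. coord s i (X \<omega>)) \<in> borel_measurable M" if "i \<in> ?V" for i
    using measurable_compose[OF meas_X meas_coord[OF that]] .
  have meas_g: "g i \<in> borel_measurable borel" for i
    unfolding g_def by measurable
  have formula: "emeasure M {\<omega>\<in>space M. \<forall>i\<in>?V. coord s i (X \<omega>) \<in> B i}
      = (\<Prod>i\<in>?V. \<integral>\<^sup>+w. g i w * indicator (B i) w \<partial>lborel) / Z"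
    if B: "\<And>i. i \<in> ?V \<Longrightarrow> B i \<in> sets borel" for B
  proof -
    define A where "A = {y\<in>space ?N. \<forall>i\<in>?V. coord s i y \<in> B i}"
    have A[measurable]: "A \<in> sets ?N"
      unfolding A_def using finite_verts meas_coord B
      by (intro sets.sets_Collect_finite_All) (auto simp: measurable_sets_borel vimage_def
        intro: measurable_sets_Collect)
    \<comment> \<open>The share of vertex \<open>i\<close> in \<open>delta powr b\<close> and in the indicator of the event.\<close>
    define h where "h i w = ennreal ((1 + s * w) powr b) * indicator (B i) w" for i w
    let ?term = "\<lambda>j y. ennreal (y j powr (\<alpha> j - 1)) * h j (coord s j y) * indicator ?R (coord s j y)"
    have density: "ennreal (f y) * indicator A y = (\<Prod>j\<in>?V. ?term j y)" if y: "y \<in> space ?N" for y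
    proof (cases "\<forall>i\<in>?V. coord s i y \<in> ?R")
      case False
      then have "(\<Prod>j\<in>?V. ?term j y) = 0" using finite_verts by (auto intro!: prod_zero simp: indicator_eq_0_iff)
      moreover have "y \<notin> coord_support s" using False coord_support_iff[OF s y] by simp
      ultimately show ?thesis by (simp add: f_def)
    next
      case True
      then have supp: "y \<in> coord_support s" using coord_support_iff[OF s y] by simp
      have delta: "delta_on G ?V (\<lambda>i. s * y i) = (\<Prod>i\<in>?V. 1 + s * coord s i y)"
        using s by (rule delta_on_verts_eq_prod_coord) (use True in blast)
      have "f y = (\<Prod>i\<in>?V. (1 + s * coord s i y) powr b * y i powr (\<alpha> i - 1))"
        using supp by (simp add: f_def delta prod.distrib prod_powr_distrib)
      then have "ennreal (f y)
          = (\<Prod>i\<in>?V. ennreal ((1 + s * coord s i y) powr b) * ennreal (y i powr (\<alpha> i - 1)))"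
        by (simp add: ennreal_mult flip: prod_ennreal)
      moreover have "indicator A y = (\<Prod>i\<in>?V. indicator (B i) (coord s i y) :: ennreal)"
      proof (cases "y \<in> A")
        case True
        then show ?thesis by (simp add: A_def)
      next
        case False
        then have "(\<Prod>i\<in>?V. indicator (B i) (coord s i y) :: ennreal) = 0"
          using y finite_verts by (auto simp: A_def indicator_eq_0_iff intro!: prod_zero)
        then show ?thesis using False by simp
      qed
      ultimately show ?thesis
        using True by (simp add: h_def prod.distrib ac_simps cong: prod.cong)
    qed
    have "{\<omega>\<in>space M. \<forall>i\<in>?V. coord s i (X \<omega>) \<in> B i} = X -` A \<inter> space M"
      using measurable_space[OF meas_X] by (auto simp: A_def)
    then have "emeasure M {\<omega>\<in>space M. \<forall>i\<in>?V. coord s i (X \<omega>) \<in> B i}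
        = (\<integral>\<^sup>+y. normalized ?N f y * indicator A y \<partial>?N)"
      using distributed_emeasure[OF X A] by simp
    also have "\<dots> = (\<integral>\<^sup>+y. (\<Prod>j\<in>?V. ?term j y) / Z \<partial>?N)"
    proof (rule nn_integral_cong)
      fix y assume y: "y \<in> space ?N"
      show "normalized ?N f y * indicator A y = (\<Prod>j\<in>?V. ?term j y) / Z"
        unfolding density[OF y, symmetric]
        by (simp add: normalized_def Z_def divide_ennreal_def ac_simps)
    qed
    also have "\<dots> = (\<integral>\<^sup>+y. (\<Prod>j\<in>?V. ?term j y) \<partial>?N) / Z"
    proof (rule nn_integral_divide, rule borel_measurable_prod_ennreal)
      fix j assume j: "j \<in> ?V"
      note [measurable] = meas_coord[OF j] B[OF j]
      have [measurable]: "(\<lambda>y. y j) \<in> borel_measurable ?N"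
        unfolding lebesgue_on_verts_def
        using measurable_component_singleton[OF j, of "\<lambda>_. lborel"] by simp
      show "?term j \<in> borel_measurable ?N" unfolding h_def by measurable
    qed
    also have "(\<integral>\<^sup>+y. (\<Prod>j\<in>?V. ?term j y) \<partial>?N)
        = (\<Prod>j\<in>?V. \<integral>\<^sup>+w. ennreal (w powr (\<alpha> j - 1)) * h j w *
            ennreal ((1 + s * w) powr (\<Sum>k\<in>pa D j \<inter> ?V. \<alpha> k)) * indicator ?R w \<partial>lborel)"
      unfolding lebesgue_on_verts_def using s desc_closed_refl
    proof (rule nn_integral_coord)
      fix j assume "j \<in> ?V"
      note [measurable] = B[OF this]
      show "h j \<in> borel_measurable borel" unfolding h_def[abs_def] by measurable
    qed
    also have "\<dots> = (\<Prod>i\<in>?V. \<integral>\<^sup>+w. g i w * indicator (B i) w \<partial>lborel)"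
      unfolding sub
    proof (intro prod.cong nn_integral_cong refl)
      fix j w
      show "ennreal (w powr (\<alpha> j - 1)) * h j w *
            ennreal ((1 + s * w) powr (\<Sum>k\<in>pa D j. \<alpha> k)) * indicator ?R w = g j w * indicator (B j) w"
        by (cases "w \<in> ?R") (simp_all add: g_def h_def powr_add ennreal_mult ac_simps)
    qed
    finally show ?thesis .
  qed
  show "indep_vars (\<lambda>_. borel) (\<lambda>i \<omega>. coord s i (X \<omega>)) ?V"
    using finite_verts meas_W meas_g formula
    by (rule indep_vars_and_distributed_of_product_formula)
  fix i assume "i \<in> ?V"
  with finite_verts meas_W meas_g formula
  have "distributed M lborel (\<lambda>\<omega>. coord s i (X \<omega>)) (\<lambda>w. g i w / (\<integral>\<^sup>+w. g i w \<partial>lborel))"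
    by (rule indep_vars_and_distributed_of_product_formula)
  then show "distributed M lborel (\<lambda>\<omega>. coord s i (X \<omega>))
      (normalized lborel (\<lambda>w. w powr (\<alpha> i - 1) *
        (1 + s * w) powr (b + (\<Sum>k\<in>pa D i. \<alpha> k)) * indicator ?R w))"
    by (simp add: normalized_def[abs_def] g_def)
qed

lemma coord_minus_one:
  assumes "i \<in> verts G"
  shows "coord (-1) i y = 1 - Delta_on G (de_bar D i) y / Delta_on G (de D i) y"
  using assms finite_vertex_set[OF de_subset[of i]]
  by (simp add: coord_def de_bar_def Delta_on_eq_delta_on)

lemma coord_one:
  "coord 1 i y = delta_on G (de_bar D i) y / delta_on G (de D i) y - 1"
  by (simp add: coord_def)

lemma Dir_density_eq:
  "Dir_density G \<alpha> \<beta> = normalized (lebesgue_on_verts G) (\<lambda>y.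
     delta_on G (verts G) (\<lambda>i. -1 * y i) powr (\<beta> - 1) *
       (\<Prod>i\<in>verts G. y i powr (\<alpha> i - 1)) * indicator (coord_support (-1)) y)"
proof -
  have "M_set G = coord_support (-1)"
    by (auto simp: M_set_def coord_support_def Delta_on_eq_delta_on[OF finite_vertex_set])
  moreover have "Delta G y = delta_on G (verts G) (\<lambda>i. -1 * y i)" for y
    using Delta_on_eq_delta_on[OF finite_verts, of G y] by (simp add: Delta_on_def induced_verts)
  ultimately show ?thesis by (simp add: Dir_density_def)
qed

lemma IDir_density_eq:
  "IDir_density G \<alpha> \<beta> = normalized (lebesgue_on_verts G) (\<lambda>y.
     delta_on G (verts G) (\<lambda>i. 1 * y i) powr (- \<beta>) *
       (\<Prod>i\<in>verts G. y i powr (\<alpha> i - 1)) * indicator (coord_support 1) y)"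
proof -
  have "pos_orthant G = coord_support 1"
  proof -
    have "0 < delta_on G A (\<lambda>i. 1 * y i)" if "y \<in> pos_orthant G" "A \<subseteq> verts G" for y A
      using that finite_vertex_set by (intro delta_on_pos) (auto simp: pos_orthant_def PiE_iff)
    then show ?thesis by (auto simp: coord_support_def)
  qed
  then show ?thesis by (simp add: IDir_density_def delta_on_def induced_verts)
qed

lemma pa_not_refl: "i \<notin> pa D i"
  using acyclic_D by (auto simp: pa_def acyclic_def)

lemma Beta1_density_eq:
  "Beta1_density a b =
    normalized lborel (\<lambda>w. w powr (a - 1) * (1 + -1 * w) powr (b - 1) * indicator (coord_range (-1)) w)"
proof -
  have "coord_range (-1) = {0<..<1}" by (auto simp: coord_range_def)
  then show ?thesis by (simp add: Beta1_density_def)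
qed

lemma Beta2_density_eq:
  "Beta2_density a b =
    normalized lborel (\<lambda>w. w powr (a - 1) * (1 + 1 * w) powr (- (a + b)) * indicator (coord_range 1) w)"
proof -
  have "coord_range 1 = {0<..}" by (auto simp: coord_range_def)
  then show ?thesis by (simp add: Beta2_density_def)
qed

end

theorem theorem5p6:
  fixes G :: "'v graph" and D :: "'v rel"
  assumes "simple_graph G"
    and "moral_dag G D"
  shows "(\<forall>(M :: 'b measure) (X :: 'b \<Rightarrow> 'v \<Rightarrow> real) (\<alpha> :: 'v \<Rightarrow> real) (\<beta> :: real).
            prob_space M \<and> (\<forall>i\<in>verts G. \<alpha> i > 0) \<and> \<beta> > 0 \<and>
            distributed M (lebesgue_on_verts G) X (Dir_density G \<alpha> \<beta>) \<longrightarrow>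
            (let U = (\<lambda>i \<omega>. 1 - Delta_on G (de_bar D i) (X \<omega>) / Delta_on G (de D i) (X \<omega>)) in
               prob_space.indep_vars M (\<lambda>_. borel) U (verts G) \<and>
               (\<forall>i\<in>verts G. distributed M lborel (U i)
                  (Beta1_density (\<alpha> i) (\<beta> + (\<Sum>j\<in>pa D i. \<alpha> j)))))) \<and>
         (\<forall>(N :: 'c measure) (Y :: 'c \<Rightarrow> 'v \<Rightarrow> real) (\<alpha> :: 'v \<Rightarrow> real) (\<beta> :: real).
            prob_space N \<and> (\<forall>i\<in>verts G. \<alpha> i > 0) \<and>
            \<beta> > Max ((\<lambda>C. \<Sum>i\<in>C. \<alpha> i) ` max_cliques G) \<and>
            distributed N (lebesgue_on_verts G) Y (IDir_density G \<alpha> \<beta>) \<longrightarrow>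
            (let W = (\<lambda>i \<omega>. delta_on G (de_bar D i) (Y \<omega>) / delta_on G (de D i) (Y \<omega>) - 1) in
               prob_space.indep_vars N (\<lambda>_. borel) W (verts G) \<and>
               (\<forall>i\<in>verts G. distributed N lborel (W i)
                  (Beta2_density (\<alpha> i) (\<beta> - (\<Sum>j\<in>pa_bar D i. \<alpha> j))))))"
proof -
  interpret moral_graph G D by standard (fact assms)+
  show ?thesis
  proof (intro conjI allI impI; elim conjE)
    fix M :: "'b measure" and X :: "'b \<Rightarrow> 'v \<Rightarrow> real" and \<alpha> :: "'v \<Rightarrow> real" and \<beta> :: real
    assume M: "prob_space M" and X: "distributed M (lebesgue_on_verts G) X (Dir_density G \<alpha> \<beta>)"
    interpret prob_space M by (rule M)
    define U where
      "U = (\<lambda>i \<omega>. 1 - Delta_on G (de_bar D i) (X \<omega>) / Delta_on G (de D i) (X \<omega>))"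
    have U: "(\<lambda>\<omega>. coord (-1) i (X \<omega>)) = U i" if "i \<in> verts G" for i
      using coord_minus_one[OF that] by (simp add: U_def)
    have "indep_vars (\<lambda>_. borel) (\<lambda>i \<omega>. coord (-1) i (X \<omega>)) (verts G)"
      by (rule coord_independent_and_distributed[OF _ M X[unfolded Dir_density_eq]]) simp
    then have "indep_vars (\<lambda>_. borel) U (verts G)"
      by (subst (asm) indep_vars_cong[OF refl U refl])
    moreover have "distributed M lborel (U i) (Beta1_density (\<alpha> i) (\<beta> + (\<Sum>j\<in>pa D i. \<alpha> j)))"
      if i: "i \<in> verts G" for i
    proof -
      have eq: "\<beta> + (\<Sum>j\<in>pa D i. \<alpha> j) - 1 = \<beta> - 1 + (\<Sum>j\<in>pa D i. \<alpha> j)" by simp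
      show ?thesis
        unfolding U[OF i, symmetric] Beta1_density_eq eq
        using coord_independent_and_distributed(2)[OF _ M X[unfolded Dir_density_eq] i] by simp
    qed
    ultimately show "let U = \<lambda>i \<omega>. 1 - Delta_on G (de_bar D i) (X \<omega>) / Delta_on G (de D i) (X \<omega>)
      in indep_vars (\<lambda>_. borel) U (verts G) \<and>
        (\<forall>i\<in>verts G. distributed M lborel (U i)
          (Beta1_density (\<alpha> i) (\<beta> + (\<Sum>j\<in>pa D i. \<alpha> j))))"
      unfolding Let_def U_def[symmetric] by blast
  next
    fix N :: "'c measure" and Y :: "'c \<Rightarrow> 'v \<Rightarrow> real" and \<alpha> :: "'v \<Rightarrow> real" and \<beta> :: real
    assume N: "prob_space N" and Y: "distributed N (lebesgue_on_verts G) Y (IDir_density G \<alpha> \<beta>)"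
    interpret prob_space N by (rule N)
    define W where
      "W = (\<lambda>i \<omega>. delta_on G (de_bar D i) (Y \<omega>) / delta_on G (de D i) (Y \<omega>) - 1)"
    have W: "(\<lambda>i \<omega>. coord 1 i (Y \<omega>)) = W"
      by (simp add: W_def coord_one)
    have "indep_vars (\<lambda>_. borel) W (verts G)"
      unfolding W[symmetric]
      by (rule coord_independent_and_distributed[OF _ N Y[unfolded IDir_density_eq]]) simp
    moreover have "distributed N lborel (W i) (Beta2_density (\<alpha> i) (\<beta> - (\<Sum>j\<in>pa_bar D i. \<alpha> j)))"
      if i: "i \<in> verts G" for i
    proof -
      have "finite (pa D i)" using D_subset by (intro finite_vertex_set) (auto simp: pa_def)
      then have eq: "- (\<alpha> i + (\<beta> - (\<Sum>j\<in>pa_bar D i. \<alpha> j))) = - \<beta> + (\<Sum>j\<in>pa D i. \<alpha> j)"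
        using pa_not_refl by (simp add: pa_bar_def)
      show ?thesis
        unfolding W[symmetric] Beta2_density_eq eq
        using coord_independent_and_distributed(2)[OF _ N Y[unfolded IDir_density_eq] i] by simp
    qed
    ultimately show "let W = \<lambda>i \<omega>. delta_on G (de_bar D i) (Y \<omega>) / delta_on G (de D i) (Y \<omega>) - 1
      in indep_vars (\<lambda>_. borel) W (verts G) \<and>
        (\<forall>i\<in>verts G. distributed N lborel (W i)
          (Beta2_density (\<alpha> i) (\<beta> - (\<Sum>j\<in>pa_bar D i. \<alpha> j))))"
      unfolding Let_def W_def[symmetric] by blast
  qed
qed

end
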